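(* Let $\alpha>0$ and $a<b$, and assume $f\in C^{\lceil\alpha\rceil-1}[a,b]$ to be such that $D_{*a}^\alpha f\in C[a,b]$. Then there exists some $\xi\in(a,b)$ such that $$\frac{f(b)-T_{\lceil\alpha\rceil-1}[f;a](b)}{(b-a)^\alpha}=\frac{1}{\Gamma(\alpha+1)}\,D_{*a}^\alpha f(\xi).$$
   Context: All functions are real-valued; $\lceil\cdot\rceil$ is the ceiling function (rounding up to the nearest integer). $T_m[f;a]$ denotes the Taylor polynomial of degree $m$ of $f$ centered at $a$, i.e. $T_m[f;a](x)=\sum_{k=0}^m \frac{f^{(k)}(a)}{k!}(x-a)^k$. The Riemann-Liouville integral operator of order $\beta\ge 0$ is $J_a^0 h(x):=h(x)$ and, for $\beta>0$, $$J_a^\beta h(x):=\frac{1}{\Gamma(\beta)}\int_a^x (x-t)^{\beta-1}h(t)\,\mathrm{d}t,\qquad x\ge a.$$ The Riemann-Liouville derivative of order $\alpha>0$ is $D_a^\alpha h:=D^{\lceil\alpha\rceil}J_a^{\lceil\alpha\rceil-\alpha}h$, where $D^m$ is the classical derivative of integer order $m$ (one-sided at interval endpoints). The Caputo derivative of order $\alpha>0$ with starting point $a$ is $$D_{*a}^\alpha f:=D_a^\alpha\bigl[f-T_{\lceil\alpha\rceil-1}[f;a]\bigr].$$ *)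

theory Defs
  imports "HOL-Analysis.Analysis"
begin

text \<open>Derivatives are relative to the domain \<open>S\<close>: for \<open>S = {a..b}\<close> they are the classical
  derivatives in the interior and the one-sided derivatives at \<open>a\<close> and \<open>b\<close>, so values of \<open>f\<close>
  outside \<open>S\<close> are irrelevant.\<close>

definition nth_deriv_on :: "real set \<Rightarrow> nat \<Rightarrow> (real \<Rightarrow> real) \<Rightarrow> real \<Rightarrow> real" where
  "nth_deriv_on S n f = ((\<lambda>g x. vector_derivative g (at x within S)) ^^ n) f"

definition n_times_differentiable_on :: "nat \<Rightarrow> real set \<Rightarrow> (real \<Rightarrow> real) \<Rightarrow> bool" where
  "n_times_differentiable_on n S f \<longleftrightarrow> (\<forall>k<n. nth_deriv_on S k f differentiable_on S)"

definition Cn_on :: "nat \<Rightarrow> real set \<Rightarrow> (real \<Rightarrow> real) \<Rightarrow> bool" where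
  "Cn_on n S f \<longleftrightarrow> n_times_differentiable_on n S f \<and> continuous_on S (nth_deriv_on S n f)"

definition taylor_poly_on :: "real set \<Rightarrow> nat \<Rightarrow> (real \<Rightarrow> real) \<Rightarrow> real \<Rightarrow> real \<Rightarrow> real" where
  "taylor_poly_on S m f a x = (\<Sum>k\<le>m. nth_deriv_on S k f a / fact k * (x - a) ^ k)"

definition RL_integral :: "real \<Rightarrow> real \<Rightarrow> (real \<Rightarrow> real) \<Rightarrow> real \<Rightarrow> real" where
  "RL_integral a \<beta> h x =
     (if \<beta> = 0 then h x
      else 1 / Gamma \<beta> * (LINT t:{a..x}|lebesgue. (x - t) powr (\<beta> - 1) * h t))"

definition RL_deriv :: "real \<Rightarrow> real \<Rightarrow> real \<Rightarrow> (real \<Rightarrow> real) \<Rightarrow> real \<Rightarrow> real" where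
  "RL_deriv a b \<alpha> h =
     nth_deriv_on {a..b} (nat \<lceil>\<alpha>\<rceil>) (RL_integral a (of_int \<lceil>\<alpha>\<rceil> - \<alpha>) h)"

text \<open>\<open>nth_deriv_on\<close> is total, so existence of the fractional derivatives on \<open>{a..b}\<close> needs
  separate predicates.\<close>

definition RL_differentiable :: "real \<Rightarrow> real \<Rightarrow> real \<Rightarrow> (real \<Rightarrow> real) \<Rightarrow> bool" where
  "RL_differentiable a b \<alpha> h \<longleftrightarrow>
     n_times_differentiable_on (nat \<lceil>\<alpha>\<rceil>) {a..b} (RL_integral a (of_int \<lceil>\<alpha>\<rceil> - \<alpha>) h)"

definition caputo_deriv :: "real \<Rightarrow> real \<Rightarrow> real \<Rightarrow> (real \<Rightarrow> real) \<Rightarrow> real \<Rightarrow> real" where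
  "caputo_deriv a b \<alpha> f =
     RL_deriv a b \<alpha> (\<lambda>x. f x - taylor_poly_on {a..b} (nat \<lceil>\<alpha>\<rceil> - 1) f a x)"

definition caputo_differentiable :: "real \<Rightarrow> real \<Rightarrow> real \<Rightarrow> (real \<Rightarrow> real) \<Rightarrow> bool" where
  "caputo_differentiable a b \<alpha> f \<longleftrightarrow>
     RL_differentiable a b \<alpha> (\<lambda>x. f x - taylor_poly_on {a..b} (nat \<lceil>\<alpha>\<rceil> - 1) f a x)"

end

theory Submission
  imports Defs
begin

text \<open>Write \<open>J \<beta>\<close> for the Riemann-Liouville integral of order \<open>\<beta>\<close> based at \<open>a\<close>, and let
  \<open>\<lceil>\<alpha>\<rceil> = m + 1\<close>, \<open>\<beta> = \<lceil>\<alpha>\<rceil> - \<alpha>\<close>, \<open>h = f - T\<close> with \<open>T\<close> the Taylor polynomial of degree \<open>m\<close>, and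
  \<open>\<phi>\<close> the Caputo derivative of \<open>f\<close>. The theorem is the weighted mean value theorem applied to the
  fractional Taylor formula \<open>h b = J \<alpha> \<phi> b\<close>: the kernel of \<open>J \<alpha>\<close> is positive, and its integral over
  \<open>{a..b}\<close>, divided by \<open>Gamma \<alpha>\<close>, is \<open>(b - a) powr \<alpha> / Gamma (\<alpha> + 1)\<close>; see
  \<open>RL_integral_mean_value\<close>.

  The Taylor formula says that \<open>J \<alpha>\<close> inverts the Caputo derivative. It rests on the semigroup law
  \<open>J p (J q h) = J (p + q) h\<close> for continuous \<open>h\<close> (\<open>RL_integral_semigroup\<close>), proved by exchanging
  the order of integration and evaluating a Beta integral, and on the fact that \<open>J 1\<close> is inverse to
  differentiation. By the classical integral remainder (\<open>taylor_remainder_RL_integral\<close>),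
  \<open>h = J m \<psi>\<close>, where \<open>\<psi>\<close> is the derivative of \<open>f\<close> of order \<open>m\<close> minus its value at \<open>a\<close>. Hence
  \<open>J \<beta> h = J m (J \<beta> \<psi>)\<close>, and the derivative of order \<open>m\<close> of this function is \<open>J \<beta> \<psi>\<close>. Its
  derivative is \<open>\<phi>\<close> and it vanishes at \<open>a\<close>, so \<open>J \<beta> \<psi> = J 1 \<phi>\<close>. This is an Abel integral equation
  for \<open>\<psi>\<close>: applying \<open>J (1 - \<beta>)\<close> gives \<open>J 1 \<psi> = J 1 (J (1 - \<beta>) \<phi>)\<close>. Both integrands are
  continuous (\<open>continuous_on_RL_integral\<close>), so differentiation yields \<open>\<psi> = J (1 - \<beta>) \<phi>\<close>, and therefore
  \<open>h = J m (J (1 - \<beta>) \<phi>) = J \<alpha> \<phi>\<close>.\<close>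

section \<open>Riemann-Liouville integrals as Lebesgue integrals over the line\<close>

lemma Gamma_real_nonzero: "x > 0 \<Longrightarrow> Gamma x \<noteq> (0::real)"
  using Gamma_real_pos[of x] by (metis less_irrefl)

lemma RL_integral_cong:
  assumes "a \<le> x" and "\<And>t. t \<in> {a..x} \<Longrightarrow> g t = h t"
  shows "RL_integral a \<beta> g x = RL_integral a \<beta> h x"
proof -
  have "(LINT t:{a..x}|lebesgue. (x - t) powr (\<beta> - 1) * g t)
      = (LINT t:{a..x}|lebesgue. (x - t) powr (\<beta> - 1) * h t)"
    unfolding set_lebesgue_integral_def
    by (rule Bochner_Integration.integral_cong) (auto simp: assms(2) indicator_def)
  moreover have "g x = h x"
    using assms by auto
  ultimately show ?thesis
    by (simp add: RL_integral_def)
qed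

lemma RL_integral_lborel:
  assumes "\<beta> > 0" and [measurable]: "h \<in> borel_measurable borel"
  shows "RL_integral a \<beta> h x
    = (\<integral>t. indicator {a..x} t * ((x - t) powr (\<beta> - 1) * h t) \<partial>lborel) / Gamma \<beta>"
proof -
  have "(LINT t:{a..x}|lebesgue. (x - t) powr (\<beta> - 1) * h t)
      = (\<integral>t. indicator {a..x} t * ((x - t) powr (\<beta> - 1) * h t) \<partial>lborel)"
    unfolding set_lebesgue_integral_def real_scaleR_def
    by (rule integral_completion) simp
  then show ?thesis
    using assms(1) by (simp add: RL_integral_def)
qed

text \<open>A function given on \<open>{a..b}\<close> may be arbitrary outside. Extending it by its boundary values
  makes it Borel measurable and bounded on the whole line, as Fubini's theorem and dominated
  convergence require; by \<open>RL_integral_cong\<close> the integrals do not see the change.\<close>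

lemma bounded_continuous_extension:
  fixes h :: "real \<Rightarrow> real"
  assumes "continuous_on {a..b} h" and "a \<le> b"
  obtains g M where "continuous_on UNIV g" "\<And>t. t \<in> {a..b} \<Longrightarrow> g t = h t" "\<And>t. \<bar>g t\<bar> \<le> M"
proof -
  have "bounded (h ` {a..b})"
    using assms(1) by (intro compact_imp_bounded compact_continuous_image) auto
  then obtain M where M: "\<And>t. t \<in> {a..b} \<Longrightarrow> \<bar>h t\<bar> \<le> M"
    by (force simp: bounded_iff)
  define g where "g t = h (max a (min b t))" for t
  have "continuous_on UNIV g"
    unfolding g_def
    by (rule continuous_on_compose2[OF assms(1)]) (use assms(2) in \<open>auto intro!: continuous_intros\<close>)
  then show thesis
    by (rule that[of g M]) (use M assms(2) in \<open>auto simp: g_def\<close>)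
qed

section \<open>Beta integrals of power kernels\<close>

lemma has_bochner_integral_Beta:
  fixes p q :: real
  assumes "p > 0" "q > 0"
  shows "has_bochner_integral lborel
    (\<lambda>u. indicator {0..1} u * ((1 - u) powr (p - 1) * u powr (q - 1))) (Beta p q)"
proof -
  let ?f = "\<lambda>u::real. (1 - u) powr (p - 1) * u powr (q - 1)"
  have I: "(?f has_integral Beta p q) {0..1}"
    using has_integral_Beta_real[OF assms(2,1)] by (simp add: mult.commute Beta_commute)
  have "Beta p q \<ge> 0"
    using I by (rule has_integral_nonneg) simp
  moreover have "integral\<^sup>N lborel (\<lambda>u. ennreal (indicator {0..1} u * ?f u)) = ennreal (Beta p q)"
    using nn_integral_has_integral_lebesgue[OF _ I] by simp
  ultimately show ?thesis
    by (intro has_bochner_integral_nn_integral) auto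
qed

text \<open>The constant of the semigroup law: the substitution \<open>t = s + (x - s) u\<close> maps the
  convolution of two power kernels over \<open>{s..x}\<close> to Euler's Beta integral.\<close>

lemma has_bochner_integral_Beta_interval:
  fixes p q s x :: real
  assumes "p > 0" "q > 0" "s < x"
  shows "has_bochner_integral lborel
    (\<lambda>t. indicator {s..x} t * ((x - t) powr (p - 1) * (t - s) powr (q - 1)))
    ((x - s) powr (p + q - 1) * Beta p q)"
proof -
  define c where "c = x - s"
  have c: "c > 0" using assms(3) by (simp add: c_def)
  have x: "x = s + c" by (simp add: c_def)
  have ind: "indicator {s..x} (s + c * u) = (indicator {0..1} u :: real)" for u
    using c by (auto simp: x indicator_def mult_le_cancel_left1 zero_le_mult_iff)
  have "indicator {s..x} (s + c * u) * ((x - (s + c * u)) powr (p - 1) * (s + c * u - s) powr (q - 1))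
      = c powr (p + q - 2) * (indicator {0..1} u * ((1 - u) powr (p - 1) * u powr (q - 1)))" for u
  proof (cases "u \<in> {0..1}")
    case True
    have "x - (s + c * u) = c * (1 - u)" by (simp add: x algebra_simps)
    moreover have "c powr (p + q - 2) = c powr (p - 1) * c powr (q - 1)"
      by (simp add: powr_add[symmetric])
    ultimately show ?thesis
      using True c by (simp add: ind powr_mult)
  qed (simp add: ind)
  moreover have "(c powr (p + q - 1) * Beta p q) /\<^sub>R \<bar>c\<bar> = c powr (p + q - 2) * Beta p q"
  proof -
    have "c powr (p + q - 1) = c * c powr (p + q - 2)"
      using c powr_mult_base[of c "p + q - 2"] by (simp add: algebra_simps)
    then show ?thesis using c by simp
  qed
  ultimately have "has_bochner_integral lborel
      (\<lambda>u. indicator {s..x} (s + c * u)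
        * ((x - (s + c * u)) powr (p - 1) * (s + c * u - s) powr (q - 1)))
      ((c powr (p + q - 1) * Beta p q) /\<^sub>R \<bar>c\<bar>)"
    using has_bochner_integral_mult_right[OF has_bochner_integral_Beta[OF assms(1,2)],
        of "c powr (p + q - 2)"]
    by (simp only:)
  then show ?thesis
    using c by (subst lborel_has_bochner_integral_real_affine_iff[where c = c and t = s])
      (simp_all only: c_def[symmetric])
qed

text \<open>The case \<open>q = 1\<close> of the Beta integral; the second kernel is then \<open>1\<close> except at the
  point \<open>t = a\<close>, where \<open>0 powr 0 = 0\<close>.\<close>

lemma has_bochner_integral_powr_kernel:
  fixes p a x :: real
  assumes "p > 0" "a < x"
  shows "has_bochner_integral lborel
    (\<lambda>t. indicator {a..x} t * (x - t) powr (p - 1)) ((x - a) powr p / p)"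
proof -
  have "Beta p 1 = 1 / p"
    using assms(1) Gamma_plus1[of p] by (simp add: Beta_def Gamma_real_nonzero nonpos_Ints_def)
  then have "has_bochner_integral lborel
      (\<lambda>t. indicator {a..x} t * ((x - t) powr (p - 1) * (t - a) powr 0)) ((x - a) powr p / p)"
    using has_bochner_integral_Beta_interval[of p 1 a x] assms by simp
  moreover have "AE t in lborel. indicator {a..x} t * ((x - t) powr (p - 1) * (t - a) powr 0)
      = indicator {a..x} t * (x - t) powr (p - 1)"
    using AE_lborel_singleton[of a] by eventually_elim simp
  ultimately show ?thesis
    by (subst (asm) has_bochner_integral_cong_AE) auto
qed

lemma integrable_powr_kernel:
  fixes h :: "real \<Rightarrow> real"
  assumes "p > 0" and [measurable]: "h \<in> borel_measurable borel" and M: "\<And>t. \<bar>h t\<bar> \<le> M"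
  shows "integrable lborel (\<lambda>t. indicator {a..x} t * ((x - t) powr (p - 1) * h t))"
proof (cases "a < x")
  case True
  have "M \<ge> 0" using M[of 0] by linarith
  have "integrable lborel (\<lambda>t. M * (indicator {a..x} t * (x - t) powr (p - 1)))"
    using has_bochner_integral_powr_kernel[OF assms(1) True]
    by (intro integrable_mult_right) (simp add: has_bochner_integral_iff)
  then show ?thesis
    by (rule Bochner_Integration.integrable_bound)
      (use M \<open>M \<ge> 0\<close> in \<open>auto simp: indicator_def abs_mult mult.commute[of M] intro!: mult_left_mono\<close>)
next
  case False
  then have "AE t in lborel. indicator {a..x} t * ((x - t) powr (p - 1) * h t) = 0"
    using AE_lborel_singleton[of a] by (auto simp: indicator_def elim!: eventually_mono)
  then show ?thesis
    by (subst integrable_cong_AE[where g = "\<lambda>_. 0"]) auto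
qed

section \<open>The semigroup law and continuity\<close>

lemma borel_measurable_RL_integral:
  assumes "q > 0" and [measurable]: "h \<in> borel_measurable borel"
  shows "RL_integral a q h \<in> borel_measurable borel"
proof -
  have "RL_integral a q h
      = (\<lambda>x. (\<integral>t. (if a \<le> t \<and> t \<le> x then (x - t) powr (q - 1) * h t else 0) \<partial>lborel) / Gamma q)"
    using assms by (auto simp: RL_integral_lborel indicator_def if_distrib mult.commute
        cong: if_cong intro!: ext Bochner_Integration.integral_cong)
  then show ?thesis by simp
qed

text \<open>Written out, the left-hand side is an iterated integral of
  \<open>(x - t) powr (p - 1) * (t - s) powr (q - 1) * h s\<close> over the triangle \<open>a \<le> s \<le> t \<le> x\<close>. With
  the order of integration exchanged, the inner integral over \<open>t\<close> is the Beta integral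
  \<open>(x - s) powr (p + q - 1) * Beta p q\<close>, and
  \<open>Beta p q = Gamma p * Gamma q / Gamma (p + q)\<close> gives the normalising factor of order \<open>p + q\<close>.\<close>

lemma RL_integral_semigroup_UNIV:
  fixes h :: "real \<Rightarrow> real"
  assumes "p > 0" "q > 0" and cont: "continuous_on UNIV h" and M: "\<And>t. \<bar>h t\<bar> \<le> M"
  shows "RL_integral a p (RL_integral a q h) x = RL_integral a (p + q) h x"
proof -
  have [measurable]: "h \<in> borel_measurable borel"
    using cont by (rule borel_measurable_continuous_onI)
  note [measurable] = borel_measurable_RL_integral[OF \<open>q > 0\<close>, of h a]
  have Gamma_nonzero: "Gamma p \<noteq> 0" "Gamma q \<noteq> 0" "Gamma (p + q) \<noteq> 0"
    using assms(1,2) by (simp_all add: Gamma_real_nonzero)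
  define K where "K s t = (if a \<le> s \<and> s \<le> t \<and> t \<le> x
      then (x - t) powr (p - 1) * (t - s) powr (q - 1) * h s else 0)" for s t
  have K_measurable [measurable]: "case_prod K \<in> borel_measurable (lborel \<Otimes>\<^sub>M lborel)"
    unfolding K_def by measurable
  \<comment> \<open>Stated for a free factor \<open>c\<close>, to be used with \<open>h s\<close> for the value of the inner integral and
    with \<open>\<bar>h s\<bar>\<close> for the absolute integrability that Fubini's theorem requires.\<close>
  have kernel: "has_bochner_integral lborel
      (\<lambda>t. if a \<le> s \<and> s \<le> t \<and> t \<le> x then (x - t) powr (p - 1) * (t - s) powr (q - 1) * c else 0)
      (indicator {a..x} s * ((x - s) powr (p + q - 1) * c) * Beta p q)"
    if "s \<noteq> x" for s c
  proof (cases "s \<in> {a..x}")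
    case True
    then have "(\<lambda>t. if a \<le> s \<and> s \<le> t \<and> t \<le> x then (x - t) powr (p - 1) * (t - s) powr (q - 1) * c else 0)
        = (\<lambda>t. c * (indicator {s..x} t * ((x - t) powr (p - 1) * (t - s) powr (q - 1))))"
      by (auto simp: indicator_def)
    then show ?thesis
      using has_bochner_integral_mult_right[OF has_bochner_integral_Beta_interval[OF assms(1,2)],
          of c s x] True \<open>s \<noteq> x\<close>
      by (simp add: mult_ac)
  next
    case False
    then have "(\<lambda>t. if a \<le> s \<and> s \<le> t \<and> t \<le> x then (x - t) powr (p - 1) * (t - s) powr (q - 1) * c else 0)
        = (\<lambda>t. 0)"
      by auto
    then show ?thesis
      using False by (simp add: has_bochner_integral_zero)
  qed
  have K_inner: "has_bochner_integral lborel (K s)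
      (indicator {a..x} s * ((x - s) powr (p + q - 1) * h s) * Beta p q)" if "s \<noteq> x" for s
    using kernel[OF that, of "h s"] by (simp add: K_def[abs_def])
  have K_norm: "has_bochner_integral lborel (\<lambda>t. norm (K s t))
      (indicator {a..x} s * ((x - s) powr (p + q - 1) * \<bar>h s\<bar>) * Beta p q)" if "s \<noteq> x" for s
  proof -
    have "norm (K s t) = (if a \<le> s \<and> s \<le> t \<and> t \<le> x
        then (x - t) powr (p - 1) * (t - s) powr (q - 1) * \<bar>h s\<bar> else 0)" for t
      by (simp add: K_def abs_mult)
    then show ?thesis
      using kernel[OF that, of "\<bar>h s\<bar>"] by (simp only:)
  qed
  have ae: "AE s in lborel. s \<noteq> x" by (rule AE_lborel_singleton)
  have "integrable lborel (\<lambda>s. indicator {a..x} s * ((x - s) powr (p + q - 1) * \<bar>h s\<bar>) * Beta p q)"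
    using M assms(1,2) by (intro integrable_mult_left integrable_powr_kernel[where M = M]) auto
  moreover have "AE s in lborel. (\<integral>t. norm (K s t) \<partial>lborel)
      = indicator {a..x} s * ((x - s) powr (p + q - 1) * \<bar>h s\<bar>) * Beta p q"
    using ae by eventually_elim (use K_norm in \<open>simp add: has_bochner_integral_iff\<close>)
  ultimately have "integrable lborel (\<lambda>s. \<integral>t. norm (K s t) \<partial>lborel)"
    by (subst integrable_cong_AE) auto
  moreover have "AE s in lborel. integrable lborel (\<lambda>t. K s t)"
    using ae by eventually_elim (use K_inner in \<open>simp add: has_bochner_integral_iff\<close>)
  ultimately have "integrable (lborel \<Otimes>\<^sub>M lborel) (case_prod K)"
    by (intro lborel_pair.Fubini_integrable) auto
  then have swap: "(\<integral>t. (\<integral>s. K s t \<partial>lborel) \<partial>lborel) = (\<integral>s. (\<integral>t. K s t \<partial>lborel) \<partial>lborel)"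
    by (rule lborel_pair.Fubini_integral)
  have "(\<integral>s. K s t \<partial>lborel)
      = indicator {a..x} t * ((x - t) powr (p - 1) * (Gamma q * RL_integral a q h t))" for t
  proof (cases "t \<in> {a..x}")
    case True
    have "(\<integral>s. K s t \<partial>lborel)
        = (\<integral>s. (x - t) powr (p - 1) * (indicator {a..t} s * ((t - s) powr (q - 1) * h s)) \<partial>lborel)"
      using True by (intro Bochner_Integration.integral_cong) (auto simp: K_def indicator_def)
    then show ?thesis
      using True assms(2) by (simp add: RL_integral_lborel Gamma_nonzero)
  next
    case False
    then have "(\<lambda>s. K s t) = (\<lambda>s. 0)" by (auto simp: K_def)
    then show ?thesis using False by simp
  qed
  then have "(\<integral>t. (\<integral>s. K s t \<partial>lborel) \<partial>lborel)
      = Gamma q * (\<integral>t. indicator {a..x} t * ((x - t) powr (p - 1) * RL_integral a q h t) \<partial>lborel)"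
    by (simp add: mult_ac flip: integral_mult_right_zero)
  also have "\<dots> = Gamma p * Gamma q * RL_integral a p (RL_integral a q h) x"
    using assms by (simp add: RL_integral_lborel[of p] Gamma_nonzero)
  finally have left: "(\<integral>t. (\<integral>s. K s t \<partial>lborel) \<partial>lborel)
      = Gamma p * Gamma q * RL_integral a p (RL_integral a q h) x" .
  have "(\<integral>s. (\<integral>t. K s t \<partial>lborel) \<partial>lborel)
      = (\<integral>s. indicator {a..x} s * ((x - s) powr (p + q - 1) * h s) * Beta p q \<partial>lborel)"
  proof (rule integral_cong_AE)
    show "AE s in lborel. (\<integral>t. K s t \<partial>lborel)
        = indicator {a..x} s * ((x - s) powr (p + q - 1) * h s) * Beta p q"
      using ae by eventually_elim (use K_inner in \<open>simp add: has_bochner_integral_iff\<close>)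
  qed auto
  also have "\<dots> = Beta p q * (Gamma (p + q) * RL_integral a (p + q) h x)"
    using assms by (simp add: RL_integral_lborel Gamma_nonzero)
  also have "\<dots> = Gamma p * Gamma q * RL_integral a (p + q) h x"
    using assms by (simp add: Beta_def Gamma_nonzero)
  finally show ?thesis
    using left swap assms by (auto simp: Gamma_nonzero)
qed

text \<open>Under the rescaled integral sign \<open>x\<close> occurs neither in the domain nor in the singular kernel,
  but only in the argument of \<open>h\<close>; this is what makes the dependence on \<open>x\<close> accessible to dominated
  convergence.\<close>

lemma RL_integral_rescale:
  fixes h :: "real \<Rightarrow> real"
  assumes "\<gamma> > 0" and "a \<le> x" and "h \<in> borel_measurable borel"
  shows "RL_integral a \<gamma> h x = (x - a) powr \<gamma> / Gamma \<gamma>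
    * (\<integral>u. indicator {0..1} u * ((1 - u) powr (\<gamma> - 1) * h (a + (x - a) * u)) \<partial>lborel)"
proof (cases "x = a")
  case True
  have "AE t in lborel. indicator {a..a} t * ((a - t) powr (\<gamma> - 1) * h t) = (0::real)"
    using AE_lborel_singleton[of a] by eventually_elim simp
  then have "(\<integral>t. indicator {a..a} t * ((a - t) powr (\<gamma> - 1) * h t) \<partial>lborel) = 0"
    by (rule integral_eq_zero_AE)
  then show ?thesis
    using True assms by (simp add: RL_integral_lborel)
next
  case False
  define c where "c = x - a"
  have c: "c > 0" and x: "x = a + c" using assms(2) False by (auto simp: c_def)
  have "c * (indicator {a..x} (a + c * u) * ((x - (a + c * u)) powr (\<gamma> - 1) * h (a + c * u)))
      = c powr \<gamma> * (indicator {0..1} u * ((1 - u) powr (\<gamma> - 1) * h (a + c * u)))" for u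
  proof (cases "u \<in> {0..1}")
    case True
    have "x - (a + c * u) = c * (1 - u)" by (simp add: x algebra_simps)
    moreover have "c powr \<gamma> = c * c powr (\<gamma> - 1)"
      using c powr_mult_base[of c "\<gamma> - 1"] by simp
    ultimately show ?thesis
      using True c by (simp add: x powr_mult mult_left_le)
  next
    case False
    then have "a + c * u \<notin> {a..x}"
      using c by (auto simp: x mult_le_cancel_left1 zero_le_mult_iff)
    then show ?thesis using False by simp
  qed
  then have "(\<integral>u. c * (indicator {a..x} (a + c * u)
        * ((x - (a + c * u)) powr (\<gamma> - 1) * h (a + c * u))) \<partial>lborel)
      = (\<integral>u. c powr \<gamma> * (indicator {0..1} u * ((1 - u) powr (\<gamma> - 1) * h (a + c * u))) \<partial>lborel)"
    by (simp only:)
  then have "(\<integral>t. indicator {a..x} t * ((x - t) powr (\<gamma> - 1) * h t) \<partial>lborel)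
      = c powr \<gamma> * (\<integral>u. indicator {0..1} u * ((1 - u) powr (\<gamma> - 1) * h (a + c * u)) \<partial>lborel)"
    using c by (subst lborel_integral_real_affine[where c = c and t = a])
      (simp_all only: integral_mult_right_zero abs_of_pos real_scaleR_def less_imp_neq[symmetric] not_False_eq_True)
  then show ?thesis
    using assms(1,3) by (simp add: RL_integral_lborel c_def)
qed

text \<open>Dominated convergence in the rescaled integral, with the integrable majorant
  \<open>M * (1 - u) powr (\<gamma> - 1)\<close>.\<close>

lemma continuous_on_RL_integral:
  assumes "continuous_on {a..b} h" and "\<gamma> \<ge> 0"
  shows "continuous_on {a..b} (RL_integral a \<gamma> h)"
proof (cases "\<gamma> = 0 \<or> b < a")
  case True
  then show ?thesis using assms by (auto simp: RL_integral_def)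
next
  case False
  then have \<gamma>: "\<gamma> > 0" and "a \<le> b" using assms(2) by auto
  obtain g M where g: "continuous_on UNIV g" "\<And>t. t \<in> {a..b} \<Longrightarrow> g t = h t"
    and M: "\<And>t. \<bar>g t\<bar> \<le> M"
    using bounded_continuous_extension[OF assms(1) \<open>a \<le> b\<close>] by blast
  have [measurable]: "g \<in> borel_measurable borel"
    using g(1) by (rule borel_measurable_continuous_onI)
  define F where "F x u = indicator {0..1} u * ((1 - u) powr (\<gamma> - 1) * g (a + (x - a) * u))" for x u
  have [measurable]: "F x \<in> borel_measurable borel" for x
    unfolding F_def by measurable
  have "M \<ge> 0" using M[of 0] by linarith
  have "continuous_on {a..b} (\<lambda>x. \<integral>u. F x u \<partial>lborel)"
  proof (rule continuous_on_sequentiallyI)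
    fix X :: "nat \<Rightarrow> real" and x :: real
    assume X: "X \<longlonglongrightarrow> x"
    show "(\<lambda>n. \<integral>u. F (X n) u \<partial>lborel) \<longlonglongrightarrow> (\<integral>u. F x u \<partial>lborel)"
    proof (rule integral_dominated_convergence[where w = "\<lambda>u. M * (indicator {0..1} u * (1 - u) powr (\<gamma> - 1))"])
      show "integrable lborel (\<lambda>u. M * (indicator {0..1} u * (1 - u) powr (\<gamma> - 1)))"
        using has_bochner_integral_powr_kernel[OF \<gamma>, of 0 1]
        by (intro integrable_mult_right) (simp add: has_bochner_integral_iff)
      have "(\<lambda>n. g (a + (X n - a) * u)) \<longlonglongrightarrow> g (a + (x - a) * u)" for u
        by (rule continuous_on_tendsto_compose[OF g(1)]) (auto intro!: tendsto_intros X)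
      then show "AE u in lborel. (\<lambda>n. F (X n) u) \<longlonglongrightarrow> F x u"
        unfolding F_def by (auto intro!: tendsto_intros)
      show "AE u in lborel. norm (F (X n) u) \<le> M * (indicator {0..1} u * (1 - u) powr (\<gamma> - 1))" for n
        using M by (auto simp: F_def abs_mult indicator_def mult.commute[of M] intro!: mult_left_mono)
    qed auto
  qed
  moreover have "continuous_on {a..b} (\<lambda>x. (x - a) powr \<gamma>)"
    using \<gamma> by (intro continuous_on_powr' continuous_intros) auto
  ultimately have "continuous_on {a..b} (\<lambda>x. (x - a) powr \<gamma> / Gamma \<gamma> * (\<integral>u. F x u \<partial>lborel))"
    using Gamma_real_nonzero[OF \<gamma>]
    by (intro continuous_on_mult continuous_on_divide continuous_on_const) auto
  moreover have "(x - a) powr \<gamma> / Gamma \<gamma> * (\<integral>u. F x u \<partial>lborel) = RL_integral a \<gamma> h x"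
    if "x \<in> {a..b}" for x
  proof -
    have "RL_integral a \<gamma> h x = RL_integral a \<gamma> g x"
      using that g(2) by (intro RL_integral_cong) auto
    then show ?thesis
      using \<gamma> that by (simp add: RL_integral_rescale F_def)
  qed
  ultimately show ?thesis
    by (rule continuous_on_eq)
qed

lemma RL_integral_semigroup:
  assumes "continuous_on {a..b} h" and "p \<ge> 0" "q \<ge> 0" and "x \<in> {a..b}"
  shows "RL_integral a p (RL_integral a q h) x = RL_integral a (p + q) h x"
proof (cases "p = 0 \<or> q = 0")
  case True
  moreover have "RL_integral a 0 k = k" for k
    by (simp add: RL_integral_def fun_eq_iff)
  ultimately show ?thesis by auto
next
  case False
  then have pq: "p > 0" "q > 0" using assms by auto
  obtain g M where g: "continuous_on UNIV g" "\<And>t. t \<in> {a..b} \<Longrightarrow> g t = h t"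
    and M: "\<And>t. \<bar>g t\<bar> \<le> M"
    using bounded_continuous_extension[OF assms(1)] assms(4) by auto
  have cong: "RL_integral a r h y = RL_integral a r g y" if "y \<in> {a..b}" for r y
    using that g(2) by (intro RL_integral_cong) auto
  have "RL_integral a p (RL_integral a q h) x = RL_integral a p (RL_integral a q g) x"
    using assms(4) by (intro RL_integral_cong cong) auto
  then show ?thesis
    using RL_integral_semigroup_UNIV[OF pq g(1) M] cong[OF assms(4)] by simp
qed

section \<open>Order one and the fundamental theorem of calculus\<close>

lemma RL_integral_1:
  assumes "continuous_on {a..b} h" and "x \<in> {a..b}"
  shows "RL_integral a 1 h x = integral {a..x} h"
proof -
  have cont: "continuous_on {a..x} h"
    using assms by (auto intro: continuous_on_subset)
  obtain g M where g: "continuous_on UNIV g" "\<And>t. t \<in> {a..x} \<Longrightarrow> g t = h t"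
    using bounded_continuous_extension[OF cont] assms(2) by (metis atLeastAtMost_iff)
  have [measurable]: "g \<in> borel_measurable borel"
    using g(1) by (rule borel_measurable_continuous_onI)
  have "RL_integral a 1 h x = RL_integral a 1 g x"
    using assms(2) g(2) by (intro RL_integral_cong) auto
  also have "\<dots> = (\<integral>t. indicator {a..x} t * ((x - t) powr 0 * g t) \<partial>lborel)"
    by (simp add: RL_integral_lborel)
  also have "\<dots> = (LINT t:{a..x}|lborel. g t)"
    unfolding set_lebesgue_integral_def
  proof (rule integral_cong_AE)
    show "AE t in lborel. indicator {a..x} t * ((x - t) powr 0 * g t) = indicator {a..x} t *\<^sub>R g t"
      using AE_lborel_singleton[of x] by eventually_elim simp
  qed auto
  also have "\<dots> = integral {a..x} g"
    using continuous_on_subset[OF g(1)]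
    by (intro set_borel_integral_eq_integral borel_integrable_atLeastAtMost') auto
  also have "\<dots> = integral {a..x} h"
    using g(2) by (intro integral_cong) auto
  finally show ?thesis .
qed

lemma has_vector_derivative_RL_integral_1:
  assumes "continuous_on {a..b} h" and "x \<in> {a..b}"
  shows "(RL_integral a 1 h has_vector_derivative h x) (at x within {a..b})"
  using integral_has_vector_derivative[OF assms]
  by (rule has_vector_derivative_transform[OF assms(2), rotated]) (simp add: RL_integral_1[OF assms(1)])

text \<open>The fundamental theorem of calculus for functions vanishing at the base point. Together with
  \<open>has_vector_derivative_RL_integral_1\<close> it makes the operator of order \<open>1\<close> the two-sided inverse
  of differentiation.\<close>

lemma RL_integral_1_derivative:
  assumes "\<And>t. t \<in> {a..b} \<Longrightarrow> (F has_vector_derivative F' t) (at t within {a..b})"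
    and "F a = 0" and "continuous_on {a..b} F'" and "x \<in> {a..b}"
  shows "F x = RL_integral a 1 F' x"
proof -
  have "(F has_vector_derivative F' t) (at t within {a..x})" if "t \<in> {a..x}" for t
    using assms(1)[of t] that assms(4) by (auto intro: has_vector_derivative_within_subset)
  then have "(F' has_integral F x - F a) {a..x}"
    using assms(4) by (intro fundamental_theorem_of_calculus) auto
  then show ?thesis
    using assms by (simp add: RL_integral_1 integral_unique)
qed

section \<open>Iterated derivatives on an interval and Taylor's formula\<close>

lemma nth_deriv_on_0 [simp]: "nth_deriv_on S 0 f = f"
  by (simp add: nth_deriv_on_def)

lemma nth_deriv_on_Suc:
  "nth_deriv_on S (Suc k) f x = vector_derivative (nth_deriv_on S k f) (at x within S)"
  by (simp add: nth_deriv_on_def)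

text \<open>Differentiating first \<open>f\<close> and then the result \<open>k\<close> times is the form of the recursion in which
  induction over the order can generalise over the function.\<close>

lemma nth_deriv_on_Suc_shift:
  "nth_deriv_on S (Suc k) f = nth_deriv_on S k (nth_deriv_on S 1 f)"
  by (simp add: nth_deriv_on_def funpow_Suc_right del: funpow.simps)

lemma nth_deriv_on_cong:
  assumes "\<And>x. x \<in> S \<Longrightarrow> f x = g x" and "x \<in> S"
  shows "nth_deriv_on S k f x = nth_deriv_on S k g x"
  using assms(2)
proof (induction k arbitrary: x)
  case 0
  then show ?case using assms(1) by simp
next
  case (Suc k)
  have "(nth_deriv_on S k f has_vector_derivative d) (at x within S)
      \<longleftrightarrow> (nth_deriv_on S k g has_vector_derivative d) (at x within S)" for d
    using has_vector_derivative_transform[OF Suc.prems, of "nth_deriv_on S k f" "nth_deriv_on S k g" d]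
      has_vector_derivative_transform[OF Suc.prems, of "nth_deriv_on S k g" "nth_deriv_on S k f" d]
      Suc.IH by auto
  then show ?case
    by (simp add: nth_deriv_on_Suc vector_derivative_def)
qed

lemma has_vector_derivative_nth_deriv_on:
  assumes "n_times_differentiable_on n {a..b} f" and "k < n" and "x \<in> {a..b}"
  shows "(nth_deriv_on {a..b} k f has_vector_derivative nth_deriv_on {a..b} (Suc k) f x)
    (at x within {a..b})"
  using assms unfolding n_times_differentiable_on_def differentiable_on_def nth_deriv_on_Suc
  by (auto simp: vector_derivative_works)

lemma RL_integral_Suc:
  assumes "continuous_on {a..b} h" and "x \<in> {a..b}"
  shows "RL_integral a (real (Suc m)) h x = RL_integral a 1 (RL_integral a (real m) h) x"
  using RL_integral_semigroup[OF assms(1), of 1 "real m" x] assms(2) by (simp add: add.commute)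

text \<open>Each differentiation removes one integration of order \<open>1\<close>, by the semigroup law.\<close>

lemma nth_deriv_on_RL_integral:
  assumes "a < b" and "continuous_on {a..b} h" and "x \<in> {a..b}"
  shows "nth_deriv_on {a..b} m (RL_integral a (real m) h) x = h x"
  using assms(3)
proof (induction m arbitrary: x)
  case 0
  then show ?case by (simp add: RL_integral_def)
next
  case (Suc m)
  have "nth_deriv_on {a..b} 1 (RL_integral a (real (Suc m)) h) y = RL_integral a (real m) h y"
    if y: "y \<in> {a..b}" for y
  proof -
    have "(RL_integral a 1 (RL_integral a (real m) h) has_vector_derivative RL_integral a (real m) h y)
        (at y within {a..b})"
      by (intro has_vector_derivative_RL_integral_1 continuous_on_RL_integral assms y) simp
    then have "(RL_integral a (real (Suc m)) h has_vector_derivative RL_integral a (real m) h y)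
        (at y within {a..b})"
      by (rule has_vector_derivative_transform[OF y, rotated]) (rule RL_integral_Suc[OF assms(2)])
    then show ?thesis
      using vector_derivative_within_closed_interval[OF assms(1) y]
      by (simp add: nth_deriv_on_Suc)
  qed
  then have "nth_deriv_on {a..b} (Suc m) (RL_integral a (real (Suc m)) h) x
      = nth_deriv_on {a..b} m (RL_integral a (real m) h) x"
    unfolding nth_deriv_on_Suc_shift by (rule nth_deriv_on_cong) (use Suc.prems in auto)
  with Suc show ?case by simp
qed

lemma has_vector_derivative_taylor_poly_on:
  "(taylor_poly_on S (Suc m) f a has_vector_derivative taylor_poly_on S m (nth_deriv_on S 1 f) a x)
    (at x within T)"
proof -
  define c where "c k = nth_deriv_on S k f a" for k
  have "((\<lambda>x. c 0 + (\<Sum>k\<le>m. c (Suc k) / fact (Suc k) * (x - a) ^ Suc k)) has_real_derivative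
      (\<Sum>k\<le>m. c (Suc k) / fact k * (x - a) ^ k)) (at x within T)"
    by (auto intro!: derivative_eq_intros sum.cong simp del: power_Suc fact_Suc
        simp: fact_Suc[where 'a = real] )
  moreover have "taylor_poly_on S (Suc m) f a
      = (\<lambda>x. c 0 + (\<Sum>k\<le>m. c (Suc k) / fact (Suc k) * (x - a) ^ Suc k))"
    unfolding taylor_poly_on_def c_def by (subst sum.atMost_Suc_shift) simp
  moreover have "taylor_poly_on S m (nth_deriv_on S 1 f) a x = (\<Sum>k\<le>m. c (Suc k) / fact k * (x - a) ^ k)"
    by (simp only: taylor_poly_on_def c_def nth_deriv_on_Suc_shift)
  ultimately show ?thesis
    by (simp add: has_real_derivative_iff_has_vector_derivative)
qed

lemma Cn_on_Suc:
  "Cn_on (Suc m) S f \<longleftrightarrow> f differentiable_on S \<and> Cn_on m S (nth_deriv_on S 1 f)"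
  by (simp only: Cn_on_def n_times_differentiable_on_def nth_deriv_on_Suc_shift All_less_Suc2
      nth_deriv_on_0 conj_assoc)

text \<open>Taylor's formula of degree \<open>m\<close> in a form that needs no derivative of order \<open>m + 1\<close>: the
  remainder is expressed through the increments of the derivative of order \<open>m\<close>. In the induction
  step the left-hand side vanishes at \<open>a\<close> and its derivative is the remainder of degree \<open>m\<close> of
  \<open>f'\<close>, so one more integration recovers it.\<close>

lemma taylor_remainder_RL_integral:
  assumes "Cn_on m {a..b} f" and "x \<in> {a..b}"
  shows "f x - taylor_poly_on {a..b} m f a x
    = RL_integral a (real m) (\<lambda>t. nth_deriv_on {a..b} m f t - nth_deriv_on {a..b} m f a) x"
  using assms
proof (induction m arbitrary: f x)
  case 0
  then show ?case by (simp add: taylor_poly_on_def RL_integral_def)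
next
  case (Suc m)
  let ?S = "{a..b}"
  define f' where "f' = nth_deriv_on ?S 1 f"
  define h where "h t = nth_deriv_on ?S (Suc m) f t - nth_deriv_on ?S (Suc m) f a" for t
  have C: "f differentiable_on ?S" "Cn_on m ?S f'"
    using Suc.prems(1) by (auto simp: Cn_on_Suc f'_def)
  have h: "h = (\<lambda>t. nth_deriv_on ?S m f' t - nth_deriv_on ?S m f' a)"
    unfolding fun_eq_iff h_def f'_def nth_deriv_on_Suc_shift by blast
  have cont: "continuous_on ?S h"
    using C(2) unfolding h Cn_on_def by (auto intro!: continuous_intros)
  have IH: "f' t - taylor_poly_on ?S m f' a t = RL_integral a (real m) h t" if "t \<in> ?S" for t
    using Suc.IH[OF C(2) that] by (simp add: h)
  have "((\<lambda>t. f t - taylor_poly_on ?S (Suc m) f a t) has_vector_derivative RL_integral a (real m) h t)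
      (at t within ?S)" if "t \<in> ?S" for t
  proof -
    have "(f has_vector_derivative f' t) (at t within ?S)"
      using C(1) that by (auto simp: f'_def nth_deriv_on_Suc differentiable_on_def vector_derivative_works)
    then have "((\<lambda>t. f t - taylor_poly_on ?S (Suc m) f a t) has_vector_derivative
        f' t - taylor_poly_on ?S m f' a t) (at t within ?S)"
      unfolding f'_def by (intro derivative_intros has_vector_derivative_taylor_poly_on)
    then show ?thesis by (simp only: IH[OF that])
  qed
  moreover have "taylor_poly_on ?S (Suc m) f a a = f a"
    unfolding taylor_poly_on_def by (subst sum.atMost_Suc_shift) simp
  ultimately have "f x - taylor_poly_on ?S (Suc m) f a x = RL_integral a 1 (RL_integral a (real m) h) x"
    by (intro RL_integral_1_derivative[where b = b] continuous_on_RL_integral cont Suc.prems) auto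
  then show ?case
    using RL_integral_Suc[OF cont Suc.prems(2), of m] by (simp only: h_def[abs_def])
qed

section \<open>The mean value theorem\<close>

text \<open>The weighted mean value theorem for the kernel \<open>(b - t) powr (\<alpha> - 1)\<close>, whose total mass is
  \<open>(b - a) powr \<alpha> / \<alpha>\<close>. The point \<open>\<xi>\<close> has to lie in the open interval, so it is not enough to
  squeeze the mean between the extrema of \<open>\<phi>\<close>: if \<open>\<phi>\<close> missed the mean \<open>c\<close> on the open interval,
  then \<open>\<phi> - c\<close> would have constant sign there, yet vanishing weighted integral.\<close>

lemma RL_integral_mean_value:
  assumes "\<alpha> > 0" "a < b" and cont: "continuous_on {a..b} \<phi>"
  shows "\<exists>\<xi>\<in>{a<..<b}. RL_integral a \<alpha> \<phi> b = (b - a) powr \<alpha> / Gamma (\<alpha> + 1) * \<phi> \<xi>"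
proof (rule ccontr)
  assume no: "\<not> ?thesis"
  obtain g M where g: "continuous_on UNIV g" "\<And>t. t \<in> {a..b} \<Longrightarrow> g t = \<phi> t"
    and M: "\<And>t. \<bar>g t\<bar> \<le> M"
    using bounded_continuous_extension[OF cont] assms(2) by auto
  have [measurable]: "g \<in> borel_measurable borel"
    using g(1) by (rule borel_measurable_continuous_onI)
  have Gamma_Suc: "Gamma (\<alpha> + 1) = \<alpha> * Gamma \<alpha>"
    using assms(1) by (auto simp: Gamma_plus1 nonpos_Ints_def)
  have pos: "(b - a) powr \<alpha> > 0"
    using assms(2) by simp
  define w where "w t = indicator {a..b} t * (b - t) powr (\<alpha> - 1)" for t
  have w: "has_bochner_integral lborel w ((b - a) powr \<alpha> / \<alpha>)"
    unfolding w_def using assms by (intro has_bochner_integral_powr_kernel)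
  have wg: "has_bochner_integral lborel (\<lambda>t. w t * g t) (Gamma \<alpha> * RL_integral a \<alpha> \<phi> b)"
  proof -
    have "RL_integral a \<alpha> \<phi> b = RL_integral a \<alpha> g b"
      using assms(2) g(2) by (intro RL_integral_cong) auto
    then show ?thesis
      using assms(1) Gamma_real_nonzero[OF assms(1)]
        integrable_powr_kernel[OF assms(1) \<open>g \<in> borel_measurable borel\<close> M, of a b]
      by (simp add: has_bochner_integral_iff RL_integral_lborel w_def mult_ac)
  qed
  \<comment> \<open>The weighted mean of \<open>\<phi>\<close> over \<open>{a..b}\<close>.\<close>
  define c where "c = RL_integral a \<alpha> \<phi> b * Gamma (\<alpha> + 1) / (b - a) powr \<alpha>"
  have c_weight: "c * ((b - a) powr \<alpha> / \<alpha>) = Gamma \<alpha> * RL_integral a \<alpha> \<phi> b"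
    using pos assms(1) by (simp add: c_def Gamma_Suc)
  have "has_bochner_integral lborel (\<lambda>t. w t * g t - c * w t)
      (Gamma \<alpha> * RL_integral a \<alpha> \<phi> b - c * ((b - a) powr \<alpha> / \<alpha>))"
    by (intro has_bochner_integral_diff wg has_bochner_integral_mult_right w)
  then have zero: "has_bochner_integral lborel (\<lambda>t. w t * (g t - c)) 0"
    unfolding c_weight by (simp add: algebra_simps)
  have ne: "g t \<noteq> c" if "t \<in> {a<..<b}" for t
  proof
    assume "g t = c"
    then have "RL_integral a \<alpha> \<phi> b = (b - a) powr \<alpha> / Gamma (\<alpha> + 1) * \<phi> t"
      using that g(2)[of t] pos Gamma_Suc Gamma_real_nonzero[OF assms(1)] assms(1)
      by (simp add: c_def field_simps)
    with no that show False by blast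
  qed
  \<comment> \<open>By the intermediate value property \<open>g - c\<close> has constant sign \<open>\<sigma>\<close> on the open interval.\<close>
  have conn: "connected (g ` {a<..<b})"
    by (intro connected_continuous_image continuous_on_subset[OF g(1)]) auto
  have "(\<forall>t\<in>{a<..<b}. g t > c) \<or> (\<forall>t\<in>{a<..<b}. g t < c)"
  proof (rule ccontr)
    assume "\<not> ?thesis"
    then obtain s t where "s \<in> {a<..<b}" "t \<in> {a<..<b}" "g s \<le> c" "c \<le> g t"
      by (auto simp: not_less)
    then have "c \<in> g ` {a<..<b}"
      using connectedD_interval[OF conn, of "g s" "g t" c] by blast
    with ne show False by blast
  qed
  then obtain \<sigma> :: real where \<sigma>: "\<And>t. t \<in> {a<..<b} \<Longrightarrow> \<sigma> * (g t - c) > 0"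
  proof
    assume "\<forall>t\<in>{a<..<b}. g t > c" then show thesis by (intro that[of 1]) auto
  next
    assume "\<forall>t\<in>{a<..<b}. g t < c" then show thesis by (intro that[of "-1"]) auto
  qed
  have ends: "AE t in lborel. t \<noteq> a \<and> t \<noteq> b"
    using AE_lborel_singleton[of a] AE_lborel_singleton[of b] by eventually_elim simp
  have "has_bochner_integral lborel (\<lambda>t. \<sigma> * (w t * (g t - c))) (\<sigma> * 0)"
    by (intro has_bochner_integral_mult_right zero)
  then have "integrable lborel (\<lambda>t. \<sigma> * (w t * (g t - c)))"
    and "(\<integral>t. \<sigma> * (w t * (g t - c)) \<partial>lborel) = 0"
    by (simp_all only: has_bochner_integral_iff mult_zero_right)
  moreover have "AE t in lborel. 0 \<le> \<sigma> * (w t * (g t - c))"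
    using ends
  proof eventually_elim
    case (elim t)
    show ?case
    proof (cases "t \<in> {a<..<b}")
      case True
      have "0 \<le> w t * (\<sigma> * (g t - c))"
        by (rule mult_nonneg_nonneg[OF _ less_imp_le[OF \<sigma>[OF True]]]) (simp add: w_def)
      then show ?thesis by (simp add: mult_ac)
    next
      case False
      with elim have "w t = 0" by (auto simp: w_def indicator_def)
      then show ?thesis by simp
    qed
  qed
  ultimately have "AE t in lborel. \<sigma> * (w t * (g t - c)) = 0"
    by (simp only: integral_nonneg_eq_0_iff_AE)
  \<comment> \<open>On the open interval the integrand is positive, so the interval would be a null set.\<close>
  then have "AE t in lborel. t \<notin> {a<..<b}"
  proof eventually_elim
    case (elim t)
    show ?case
    proof
      assume t: "t \<in> {a<..<b}"
      then have "w t > 0" by (simp add: w_def)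
      with \<sigma>[OF t] elim show False by auto
    qed
  qed
  then have "emeasure lborel {a<..<b} = 0"
    by (subst (asm) AE_iff_measurable[of "{a<..<b}"]) auto
  then show False
    using assms(2) by simp
qed

theorem theorem2p3:
  fixes \<alpha> a b :: real and f :: "real \<Rightarrow> real"
  assumes "\<alpha> > 0" and "a < b"
    and "Cn_on (nat \<lceil>\<alpha>\<rceil> - 1) {a..b} f"
    and "caputo_differentiable a b \<alpha> f"
    and "continuous_on {a..b} (caputo_deriv a b \<alpha> f)"
  shows "\<exists>\<xi>\<in>{a<..<b}.
    (f b - taylor_poly_on {a..b} (nat \<lceil>\<alpha>\<rceil> - 1) f a b) / (b - a) powr \<alpha>
      = 1 / Gamma (\<alpha> + 1) * caputo_deriv a b \<alpha> f \<xi>"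
proof -
  let ?S = "{a..b}"
  define m where "m = nat \<lceil>\<alpha>\<rceil> - 1"
  define \<beta> where "\<beta> = of_int \<lceil>\<alpha>\<rceil> - \<alpha>"
  define h where "h x = f x - taylor_poly_on ?S m f a x" for x
  define \<psi> where "\<psi> t = nth_deriv_on ?S m f t - nth_deriv_on ?S m f a" for t
  define \<phi> where "\<phi> = caputo_deriv a b \<alpha> f"
  have n: "nat \<lceil>\<alpha>\<rceil> = Suc m"
    using assms(1) by (simp add: m_def)
  then have \<alpha>: "\<alpha> = real m + (1 - \<beta>)"
    using assms(1) by (simp add: \<beta>_def)
  have \<beta>: "0 \<le> \<beta>" "\<beta> < 1"
    unfolding \<beta>_def by linarith+
  have a: "a \<in> ?S" and b: "b \<in> ?S" using assms(2) by auto
  have \<phi>_cont: "continuous_on ?S \<phi>"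
    using assms(5) by (simp add: \<phi>_def)
  have \<psi>_cont: "continuous_on ?S \<psi>"
    using assms(3) unfolding \<psi>_def Cn_on_def m_def by (auto intro!: continuous_intros)
  have h: "h x = RL_integral a (real m) \<psi> x" if "x \<in> ?S" for x
    using taylor_remainder_RL_integral[of m a b f x] assms(3) that
    by (simp add: h_def \<psi>_def[abs_def] m_def)
  \<comment> \<open>\<open>G\<close> has order one less than the Riemann-Liouville derivative, so that \<open>\<phi>\<close> is its classical
    derivative.\<close>
  define G where "G = nth_deriv_on ?S m (RL_integral a \<beta> h)"
  have G: "G x = RL_integral a \<beta> \<psi> x" if "x \<in> ?S" for x
  proof -
    have "RL_integral a \<beta> h y = RL_integral a (real m) (RL_integral a \<beta> \<psi>) y" if y: "y \<in> ?S" for y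
    proof -
      have "RL_integral a \<beta> h y = RL_integral a \<beta> (RL_integral a (real m) \<psi>) y"
        using y by (intro RL_integral_cong h) auto
      then show ?thesis
        using RL_integral_semigroup[OF \<psi>_cont _ _ y] \<beta>(1) by (simp add: add.commute)
    qed
    then have "G x = nth_deriv_on ?S m (RL_integral a (real m) (RL_integral a \<beta> \<psi>)) x"
      unfolding G_def using that by (intro nth_deriv_on_cong)
    also have "\<dots> = RL_integral a \<beta> \<psi> x"
      by (intro nth_deriv_on_RL_integral continuous_on_RL_integral \<psi>_cont assms(2) \<beta> that)
    finally show ?thesis .
  qed
  have G_deriv: "(G has_vector_derivative \<phi> x) (at x within ?S)" if "x \<in> ?S" for x
  proof -
    have "n_times_differentiable_on (Suc m) ?S (RL_integral a \<beta> h)"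
      using assms(4)
      by (simp add: caputo_differentiable_def RL_differentiable_def n \<beta>_def h_def[abs_def])
    moreover have "\<phi> x = nth_deriv_on ?S (Suc m) (RL_integral a \<beta> h) x"
      by (simp add: \<phi>_def caputo_deriv_def RL_deriv_def n \<beta>_def h_def[abs_def])
    ultimately show ?thesis
      unfolding G_def using that by (simp only:) (rule has_vector_derivative_nth_deriv_on, auto)
  qed
  \<comment> \<open>At the base point a Riemann-Liouville integral of any order sees the integrand only at \<open>a\<close>.\<close>
  have "G a = 0"
  proof -
    have "RL_integral a \<beta> \<psi> a = RL_integral a \<beta> (\<lambda>_. 0) a"
      by (intro RL_integral_cong) (auto simp: \<psi>_def)
    then show ?thesis
      using G[OF a] by (simp add: RL_integral_def)
  qed
  then have Abel: "RL_integral a \<beta> \<psi> x = RL_integral a 1 \<phi> x" if "x \<in> ?S" for x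
    using RL_integral_1_derivative[OF G_deriv _ \<phi>_cont that] G[OF that] by simp
  \<comment> \<open>Abel's inversion: the operator of the complementary order \<open>1 - \<beta>\<close> completes the order \<open>\<beta>\<close>
    on the left to the integer \<open>1\<close>.\<close>
  have int_eq: "RL_integral a 1 \<psi> x = RL_integral a 1 (RL_integral a (1 - \<beta>) \<phi>) x" if x: "x \<in> ?S" for x
  proof -
    have "RL_integral a 1 \<psi> x = RL_integral a (1 - \<beta>) (RL_integral a \<beta> \<psi>) x"
      using RL_integral_semigroup[OF \<psi>_cont _ _ x, of "1 - \<beta>" \<beta>] \<beta> by simp
    also have "\<dots> = RL_integral a (1 - \<beta>) (RL_integral a 1 \<phi>) x"
      using x by (intro RL_integral_cong Abel) auto
    also have "\<dots> = RL_integral a 1 (RL_integral a (1 - \<beta>) \<phi>) x"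
      using RL_integral_semigroup[OF \<phi>_cont _ _ x] \<beta> by (simp add: add.commute)
    finally show ?thesis .
  qed
  have \<psi>: "\<psi> x = RL_integral a (1 - \<beta>) \<phi> x" if x: "x \<in> ?S" for x
  proof -
    have "(RL_integral a 1 \<psi> has_vector_derivative \<psi> x) (at x within ?S)"
      using has_vector_derivative_RL_integral_1[OF \<psi>_cont x] .
    moreover have "(RL_integral a 1 \<psi> has_vector_derivative RL_integral a (1 - \<beta>) \<phi> x) (at x within ?S)"
    proof (rule has_vector_derivative_transform[OF x int_eq])
      show "(RL_integral a 1 (RL_integral a (1 - \<beta>) \<phi>) has_vector_derivative
          RL_integral a (1 - \<beta>) \<phi> x) (at x within ?S)"
        using \<beta> by (intro has_vector_derivative_RL_integral_1 continuous_on_RL_integral \<phi>_cont x) simp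
    qed
    ultimately show ?thesis
      using vector_derivative_within_closed_interval[OF assms(2) x] by metis
  qed
  have "h b = RL_integral a (real m) (RL_integral a (1 - \<beta>) \<phi>) b"
    using h[OF b] assms(2) RL_integral_cong[of a b \<psi> _ "real m", OF _ \<psi>] by simp
  also have "\<dots> = RL_integral a \<alpha> \<phi> b"
    using RL_integral_semigroup[OF \<phi>_cont _ _ b, of "real m" "1 - \<beta>"] \<beta> \<alpha> by simp
  finally have "h b = RL_integral a \<alpha> \<phi> b" .
  moreover obtain \<xi> where "\<xi> \<in> {a<..<b}"
      "RL_integral a \<alpha> \<phi> b = (b - a) powr \<alpha> / Gamma (\<alpha> + 1) * \<phi> \<xi>"
    using RL_integral_mean_value[OF assms(1,2) \<phi>_cont] by blast
  ultimately have "h b / (b - a) powr \<alpha> = 1 / Gamma (\<alpha> + 1) * \<phi> \<xi>"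
    using assms(2) by simp
  then show ?thesis
    using \<open>\<xi> \<in> {a<..<b}\<close> by (intro bexI[of _ \<xi>]) (simp_all add: h_def m_def \<phi>_def)
qed

end
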